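(* Let $A\in\mathbb{R}^{n\times n}$ be an HSS matrix of HSS rank $r$ for a cluster tree $\mathcal{T}$ of depth $L$, with data-sparse representation given by the matrices $U_\tau,V_\tau$ (non-root nodes $\tau$), $\tilde A_{\tau,\tau'}$ ($\tau,\tau'$ sibling nodes) and $A_{\tau,\tau}$ ($\tau$ leaf node). For each node $\tau\in\mathcal{T}$ define $$D_\tau:=\begin{cases}A_{\tau,\tau} & \text{if }\tau\text{ is a leaf node},\\[4pt] \begin{bmatrix}0&\tilde A_{\alpha,\beta}\\ \tilde A_{\beta,\alpha}&0\end{bmatrix} & \text{if }\tau\text{ has children }\alpha\text{ and }\beta.\end{cases}$$ Then $\{U_\tau,V_\tau,D_\tau\}$ is a telescopic decomposition of $A$ of telescopic rank $r$ associated with $\mathcal{T}$.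
   Context: **Cluster trees.** A cluster tree $\mathcal{T}$ of depth $L$ for $I=[1,\dots,n]$ is a perfect binary tree of depth $L$ whose root $\gamma$ is associated with $I$, and such that each non-leaf node $\tau$ with index vector $I_\tau$ has two children $\alpha,\beta$ (in this order) associated with vectors of consecutive indices $I_\alpha,I_\beta$ whose concatenation is $I_\tau$. The depth of a node is its distance from the root; $|\tau|$ is the length of $I_\tau$. $A_{\tau,\tau'}$ is the submatrix of $A$ with row indices $I_\tau$ and column indices $I_{\tau'}$. Siblings are distinct children of the same node. For integers $m,\ell$, $\mathcal{T}_m^{(\ell)}$ is the balanced cluster tree of depth $\ell$ for $[1,\dots,2^\ell m]$ with leaves associated with $[(i-1)m+1,\dots,im]$, $i=1,\dots,2^\ell$; for $\ell<L$ its nodes are identified with the nodes of $\mathcal{T}$ of depth at most $\ell$. For matrices $C_\tau$ indexed by nodes, $\boldsymbol{C}^{(\ell)}$ denotes the block diagonal matrix whose diagonal blocks are the $C_\tau$ with $\mathrm{depth}(\tau)=\ell$, in natural (left-to-right) order. **HSS matrices and data-sparse representation.** $A\in\mathbb{R}^{n\times n}$ is an HSS matrix of HSS rank $r$ for $\mathcal{T}$ if: (1) for each pair of siblings $\tau,\tau'$ there are $U_\tau^{(\mathrm{big})}\in\mathbb{R}^{|\tau|\times r}$, $V_{\tau'}^{(\mathrm{big})}\in\mathbb{R}^{|\tau'|\times r}$ with orthonormal columns (one such pair $U^{(\mathrm{big})}_\tau,V^{(\mathrm{big})}_\tau$ for each non-root node $\tau$) and $\tilde A_{\tau,\tau'}\in\mathbb{R}^{r\times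 r}$ with $A_{\tau,\tau'}=U_\tau^{(\mathrm{big})}\tilde A_{\tau,\tau'}(V_{\tau'}^{(\mathrm{big})})^T$; (2) for each non-leaf, non-root node $\tau$ with children $\alpha,\beta$ there are $U_\tau,V_\tau\in\mathbb{R}^{2r\times r}$ with orthonormal columns such that $U_\tau^{(\mathrm{big})}=\mathrm{blkdiag}(U_\alpha^{(\mathrm{big})},U_\beta^{(\mathrm{big})})U_\tau$ and $V_\tau^{(\mathrm{big})}=\mathrm{blkdiag}(V_\alpha^{(\mathrm{big})},V_\beta^{(\mathrm{big})})V_\tau$. For a (non-root) leaf $\tau$ set $U_\tau:=U_\tau^{(\mathrm{big})}$, $V_\tau:=V_\tau^{(\mathrm{big})}$. The data-sparse representation of $A$ consists of all these $U_\tau,V_\tau$, the $\tilde A_{\tau,\tau'}$ for siblings $\tau,\tau'$, and the diagonal blocks $A_{\tau,\tau}$ for leaves $\tau$; these determine $A$. **Telescopic decompositions.** A telescopic decomposition $\{U_\tau,V_\tau,D_\tau\}_{\tau\in\mathcal{T}}$ of telescopic rank $r$ of $A\in\mathbb{R}^{n\times n}$ consists of real matrices $U_\tau,V_\tau$ (for $\mathrm{depth}(\tau)\ge 1$) and $D_\tau$ (all $\tau$) such that: $D_\tau$ is $|\tau|\times|\tau|$ if $\mathrm{depth}(\tau)=L$ and $2r\times2r$ otherwise; $U_\tau,V_\tau$ have orthonormal columns and are $|\tau|\times r$ if $\mathrm{depth}(\tau)=L$ and $2r\times r$ otherwise; if $L=0$ then $A=D_\gamma$; if $L\ge1$ then $A=\boldsymbol{D}^{(L)}+\boldsymbol{U}^{(L)}A^{(L-1)}(\boldsymbol{V}^{(L)})^T$,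 where $A^{(L-1)}:=(\boldsymbol{U}^{(L)})^T(A-\boldsymbol{D}^{(L)})\boldsymbol{V}^{(L)}$ has (recursively) the telescopic decomposition $\{U_\tau,V_\tau,D_\tau\}_{\tau\in\mathcal{T}_{2r}^{(L-1)}}$. *)

theory Defs
  imports "Jordan_Normal_Form.Matrix" "Jordan_Normal_Form.DL_Submatrix"
begin

(* The node (l, i) is the i-th node from the left, counted from 0, among the nodes of depth l of
   a perfect binary tree. The nodes of depth at most l of a tree of depth L are therefore
   literally the nodes of every tree of depth l, as the recursion below requires.
   Matrix indices are 0-based: the index vector of the root is [0..<n]. *)
type_synonym node = "nat \<times> nat"

abbreviation depth :: "node \<Rightarrow> nat" where
  "depth \<equiv> fst"

definition nodes :: "nat \<Rightarrow> node set" where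
  "nodes L = {(l, i). l \<le> L \<and> i < 2 ^ l}"

definition root :: node where
  "root = (0, 0)"

definition lchild :: "node \<Rightarrow> node" where
  "lchild \<tau> = (fst \<tau> + 1, 2 * snd \<tau>)"

definition rchild :: "node \<Rightarrow> node" where
  "rchild \<tau> = (fst \<tau> + 1, 2 * snd \<tau> + 1)"

definition siblings :: "nat \<Rightarrow> node \<Rightarrow> node \<Rightarrow> bool" where
  "siblings L \<tau> \<tau>' \<longleftrightarrow>
     \<tau> \<noteq> \<tau>' \<and> (\<exists>\<rho>\<in>nodes L. depth \<rho> < L \<and>
       \<tau> \<in> {lchild \<rho>, rchild \<rho>} \<and> \<tau>' \<in> {lchild \<rho>, rchild \<rho>})"

(* That every index vector consists of consecutive indices follows from the two conditions. *)
definition cluster_tree :: "nat \<Rightarrow> nat \<Rightarrow> (node \<Rightarrow> nat list) \<Rightarrow> bool" where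
  "cluster_tree n L I \<longleftrightarrow>
     I root = [0..<n] \<and>
     (\<forall>\<tau>\<in>nodes L. depth \<tau> < L \<longrightarrow> I \<tau> = I (lchild \<tau>) @ I (rchild \<tau>))"

(* Index vectors of the balanced tree of depth k with leaves of size m. *)
definition balanced_tree :: "nat \<Rightarrow> nat \<Rightarrow> node \<Rightarrow> nat list" where
  "balanced_tree m k \<tau> =
     [snd \<tau> * 2 ^ (k - depth \<tau>) * m ..< (snd \<tau> + 1) * 2 ^ (k - depth \<tau>) * m]"

(* Index vectors of cluster trees are increasing, so nothing is lost by passing to sets. *)
definition cluster_block ::
    "(node \<Rightarrow> nat list) \<Rightarrow> real mat \<Rightarrow> node \<Rightarrow> node \<Rightarrow> real mat" where
  "cluster_block I A \<tau> \<tau>' = submatrix A (set (I \<tau>)) (set (I \<tau>'))"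

definition level_diag :: "nat \<Rightarrow> (node \<Rightarrow> real mat) \<Rightarrow> real mat" where
  "level_diag l C = diag_block_mat (map (\<lambda>i. C (l, i)) [0..<2 ^ l])"

definition orthonormal_columns :: "real mat \<Rightarrow> bool" where
  "orthonormal_columns Q \<longleftrightarrow>
     (\<forall>i<dim_col Q. \<forall>j<dim_col Q. col Q i \<bullet> col Q j = (if i = j then 1 else 0))"

(* Conditions (1) and (2) in the definition of an HSS matrix. U and V hold the transfer
   matrices and are constrained here only at nodes that are neither the root nor leaves. *)
definition hss_conditions ::
    "nat \<Rightarrow> (node \<Rightarrow> nat list) \<Rightarrow> nat \<Rightarrow> real mat \<Rightarrow>
     (node \<Rightarrow> real mat) \<Rightarrow> (node \<Rightarrow> real mat) \<Rightarrow> (node \<Rightarrow> node \<Rightarrow> real mat) \<Rightarrow>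
     (node \<Rightarrow> real mat) \<Rightarrow> (node \<Rightarrow> real mat) \<Rightarrow> bool" where
  "hss_conditions L I r A Ubig Vbig At U V \<longleftrightarrow>
     (\<forall>\<tau>\<in>nodes L. 1 \<le> depth \<tau> \<longrightarrow>
        Ubig \<tau> \<in> carrier_mat (length (I \<tau>)) r \<and> orthonormal_columns (Ubig \<tau>) \<and>
        Vbig \<tau> \<in> carrier_mat (length (I \<tau>)) r \<and> orthonormal_columns (Vbig \<tau>)) \<and>
     (\<forall>\<tau> \<tau>'. siblings L \<tau> \<tau>' \<longrightarrow>
        At \<tau> \<tau>' \<in> carrier_mat r r \<and>
        cluster_block I A \<tau> \<tau>' = Ubig \<tau> * At \<tau> \<tau>' * transpose_mat (Vbig \<tau>')) \<and>
     (\<forall>\<tau>\<in>nodes L. 1 \<le> depth \<tau> \<and> depth \<tau> < L \<longrightarrow>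
        U \<tau> \<in> carrier_mat (2 * r) r \<and> orthonormal_columns (U \<tau>) \<and>
        V \<tau> \<in> carrier_mat (2 * r) r \<and> orthonormal_columns (V \<tau>) \<and>
        Ubig \<tau> = diag_block_mat [Ubig (lchild \<tau>), Ubig (rchild \<tau>)] * U \<tau> \<and>
        Vbig \<tau> = diag_block_mat [Vbig (lchild \<tau>), Vbig (rchild \<tau>)] * V \<tau>)"

definition hss_matrix ::
    "nat \<Rightarrow> nat \<Rightarrow> (node \<Rightarrow> nat list) \<Rightarrow> nat \<Rightarrow> real mat \<Rightarrow> bool" where
  "hss_matrix n L I r A \<longleftrightarrow>
     A \<in> carrier_mat n n \<and> (\<exists>Ubig Vbig At U V. hss_conditions L I r A Ubig Vbig At U V)"

(* The diagonal blocks of A at the leaves, which also belong to the representation, are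
   determined by A and are not a separate argument. *)
definition data_sparse_representation ::
    "nat \<Rightarrow> (node \<Rightarrow> nat list) \<Rightarrow> nat \<Rightarrow> real mat \<Rightarrow>
     (node \<Rightarrow> real mat) \<Rightarrow> (node \<Rightarrow> real mat) \<Rightarrow> (node \<Rightarrow> node \<Rightarrow> real mat) \<Rightarrow> bool" where
  "data_sparse_representation L I r A U V At \<longleftrightarrow>
     (\<exists>Ubig Vbig. hss_conditions L I r A Ubig Vbig At U V \<and>
        (\<forall>\<tau>\<in>nodes L. 1 \<le> depth \<tau> \<and> depth \<tau> = L \<longrightarrow> U \<tau> = Ubig \<tau> \<and> V \<tau> = Vbig \<tau>))"

definition telescopic_dims ::
    "nat \<Rightarrow> (node \<Rightarrow> nat list) \<Rightarrow> nat \<Rightarrow>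
     (node \<Rightarrow> real mat) \<Rightarrow> (node \<Rightarrow> real mat) \<Rightarrow> (node \<Rightarrow> real mat) \<Rightarrow> bool" where
  "telescopic_dims L I r U V D \<longleftrightarrow>
     (\<forall>\<tau>\<in>nodes L.
        let m = (if depth \<tau> = L then length (I \<tau>) else 2 * r) in
          D \<tau> \<in> carrier_mat m m \<and>
          (1 \<le> depth \<tau> \<longrightarrow>
             U \<tau> \<in> carrier_mat m r \<and> orthonormal_columns (U \<tau>) \<and>
             V \<tau> \<in> carrier_mat m r \<and> orthonormal_columns (V \<tau>)))"

fun telescopic_decomposition ::
    "nat \<Rightarrow> (node \<Rightarrow> nat list) \<Rightarrow> nat \<Rightarrow>
     (node \<Rightarrow> real mat) \<Rightarrow> (node \<Rightarrow> real mat) \<Rightarrow> (node \<Rightarrow> real mat) \<Rightarrow> real mat \<Rightarrow> bool" where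
  "telescopic_decomposition 0 I r U V D A \<longleftrightarrow>
     A \<in> carrier_mat (length (I root)) (length (I root)) \<and>
     telescopic_dims 0 I r U V D \<and>
     A = D root"
| "telescopic_decomposition (Suc k) I r U V D A \<longleftrightarrow>
     A \<in> carrier_mat (length (I root)) (length (I root)) \<and>
     telescopic_dims (Suc k) I r U V D \<and>
     (let Ul = level_diag (Suc k) U;
          Vl = level_diag (Suc k) V;
          Dl = level_diag (Suc k) D;
          A' = transpose_mat Ul * (A - Dl) * Vl
      in A = Dl + Ul * A' * transpose_mat Vl \<and>
         telescopic_decomposition k (balanced_tree (2 * r) k) r U V D A')"

end

theory Submission
  imports Defs
begin

text \<open>
  An HSS matrix is put together from its generators from the leaves upwards: the diagonal block
  of a node has the diagonal blocks of its two children on its diagonal, and its off-diagonal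
  blocks are products of a column basis, a small core \<open>At\<close> and a row basis, where the bases are
  themselves obtained from the children's bases by multiplication with the transfer matrices
  \<open>U \<tau>\<close> and \<open>V \<tau>\<close>. The functions \<open>nested_basis\<close> and \<open>assemble\<close> express this by recursion on the
  height of a node, and \<open>cluster_block_eq_assemble\<close> says that \<open>A\<close> is the matrix assembled at the
  root from the leaf blocks and the generators.

  Cutting off the deepest level of the tree turns the parents of the leaves into leaves, and the
  matrix \<open>[0, At \<alpha> \<beta>; At \<beta> \<alpha>, 0]\<close> attached to such a parent becomes its new diagonal block. The
  assembly of height \<open>k\<close> from these blocks is the middle factor that the telescopic decomposition
  asks for: every nested basis is the block diagonal matrix of the leaf bases below its node times
  the nested basis of the tree without its deepest level (\<open>nested_basis_peel\<close>), so the leaf bases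
  can be pulled out of all off-diagonal blocks at once. This gives \<open>H (k + 1) = D + U * H k * V\<^sup>T\<close>
  (\<open>assemble_peel\<close>), where \<open>D\<close>, \<open>U\<close> and \<open>V\<close> collect the leaf matrices. Because the columns of
  \<open>U\<close> and \<open>V\<close> are orthonormal, \<open>H k\<close> is also \<open>U\<^sup>T * (H (k + 1) - D) * V\<close>
  (\<open>compress_sandwich\<close>). The generators of depth less than the cut level satisfy the same
  hypotheses for the balanced tree with leaves of size \<open>2 * r\<close> (\<open>hss_generators_reduce\<close>), so
  induction on the depth finishes the proof.
\<close>

section \<open>Two by two block matrices\<close>

text \<open>
  Block diagonal matrices with two blocks are kept folded below, so that their products and
  transposes are computed block by block instead of entry by entry. Unfolding the list recursion
  would leave a spurious empty third block.
\<close>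

declare diag_block_mat.simps(2) [simp del]

lemma diag_block_mat_pair:
  "diag_block_mat [A, B] =
     four_block_mat A (0\<^sub>m (dim_row A) (dim_col B)) (0\<^sub>m (dim_row B) (dim_col A)) B"
  using diag_block_mat_append[of "[A]" "[B]"] by (simp add: Let_def)

lemma diag_block_mat_pair_carrier:
  assumes "A \<in> carrier_mat m1 n1" "B \<in> carrier_mat m2 n2"
  shows "diag_block_mat [A, B] \<in> carrier_mat (m1 + m2) (n1 + n2)"
  using assms unfolding diag_block_mat_pair by simp

lemma diag_block_mat_pair_eq:
  assumes "A \<in> carrier_mat m1 n1" "B \<in> carrier_mat m2 n2"
  shows "diag_block_mat [A, B] = four_block_mat A (0\<^sub>m m1 n2) (0\<^sub>m m2 n1) B"
  using assms unfolding diag_block_mat_pair by auto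

lemma transpose_diag_block_mat_pair:
  "transpose_mat (diag_block_mat [A, B]) = diag_block_mat [transpose_mat A, transpose_mat B]"
  unfolding diag_block_mat_pair by (rule eq_matI) auto

lemma diag_block_mat_pair_mult_left:
  fixes P1 :: "'a :: comm_ring_1 mat"
  assumes "P1 \<in> carrier_mat m1 a1" "P2 \<in> carrier_mat m2 a2"
    and "X11 \<in> carrier_mat a1 b1" "X12 \<in> carrier_mat a1 b2"
    and "X21 \<in> carrier_mat a2 b1" "X22 \<in> carrier_mat a2 b2"
  shows "diag_block_mat [P1, P2] * four_block_mat X11 X12 X21 X22 =
    four_block_mat (P1 * X11) (P1 * X12) (P2 * X21) (P2 * X22)"
  unfolding diag_block_mat_pair_eq[OF assms(1,2)]
  by (subst mult_four_block_mat[OF assms(1) _ _ assms(2) assms(3-6)])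
    (use assms in \<open>auto intro!: cong_four_block_mat\<close>)

lemma diag_block_mat_pair_mult_right:
  fixes Q1 :: "'a :: comm_ring_1 mat"
  assumes "Q1 \<in> carrier_mat b1 n1" "Q2 \<in> carrier_mat b2 n2"
    and "X11 \<in> carrier_mat a1 b1" "X12 \<in> carrier_mat a1 b2"
    and "X21 \<in> carrier_mat a2 b1" "X22 \<in> carrier_mat a2 b2"
  shows "four_block_mat X11 X12 X21 X22 * diag_block_mat [Q1, Q2] =
    four_block_mat (X11 * Q1) (X12 * Q2) (X21 * Q1) (X22 * Q2)"
  unfolding diag_block_mat_pair_eq[OF assms(1,2)]
  by (subst mult_four_block_mat[OF assms(3-6) assms(1) _ _ assms(2)])
    (use assms in \<open>auto intro!: cong_four_block_mat\<close>)

lemma diag_block_mat_pair_sandwich: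
  fixes P1 :: "'a :: comm_ring_1 mat"
  assumes "P1 \<in> carrier_mat m1 a1" "P2 \<in> carrier_mat m2 a2"
    and "Q1 \<in> carrier_mat n1 b1" "Q2 \<in> carrier_mat n2 b2"
    and "X11 \<in> carrier_mat a1 b1" "X12 \<in> carrier_mat a1 b2"
    and "X21 \<in> carrier_mat a2 b1" "X22 \<in> carrier_mat a2 b2"
  shows "diag_block_mat [P1, P2] * four_block_mat X11 X12 X21 X22 *
      transpose_mat (diag_block_mat [Q1, Q2]) =
    four_block_mat (P1 * X11 * transpose_mat Q1) (P1 * X12 * transpose_mat Q2)
                   (P2 * X21 * transpose_mat Q1) (P2 * X22 * transpose_mat Q2)"
  unfolding diag_block_mat_pair_mult_left[OF assms(1,2,5-8)] transpose_diag_block_mat_pair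
  by (rule diag_block_mat_pair_mult_right[of _ _ n1 _ _ n2 _ m1 _ _ m2]) (use assms in auto)

lemma diag_block_mat_pair_mult:
  fixes P1 :: "'a :: comm_ring_1 mat"
  assumes "P1 \<in> carrier_mat m1 a1" "P2 \<in> carrier_mat m2 a2"
    and "Q1 \<in> carrier_mat a1 n1" "Q2 \<in> carrier_mat a2 n2"
  shows "diag_block_mat [P1, P2] * diag_block_mat [Q1, Q2] = diag_block_mat [P1 * Q1, P2 * Q2]"
proof -
  have "diag_block_mat [P1, P2] * four_block_mat Q1 (0\<^sub>m a1 n2) (0\<^sub>m a2 n1) Q2 =
      four_block_mat (P1 * Q1) (P1 * 0\<^sub>m a1 n2) (P2 * 0\<^sub>m a2 n1) (P2 * Q2)"
    by (rule diag_block_mat_pair_mult_left) (use assms in auto)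
  also have "\<dots> = diag_block_mat [P1 * Q1, P2 * Q2]"
    unfolding diag_block_mat_pair using assms by (intro cong_four_block_mat) auto
  finally show ?thesis
    using diag_block_mat_pair_eq[OF assms(3,4)] by simp
qed

text \<open>
  This moves the outermost factors of two bases out of a low-rank product, which is how the leaf
  bases are pulled out of an off-diagonal block.
\<close>

lemma mult_sandwich_assoc:
  fixes P1 :: "'a :: comm_ring_1 mat"
  assumes P1: "P1 \<in> carrier_mat a b" and P2: "P2 \<in> carrier_mat b c" and X: "X \<in> carrier_mat c d"
    and Q2: "Q2 \<in> carrier_mat e d" and Q1: "Q1 \<in> carrier_mat f e"
  shows "(P1 * P2) * X * transpose_mat (Q1 * Q2) =
    P1 * (P2 * X * transpose_mat Q2) * transpose_mat Q1"
proof -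
  have t: "transpose_mat (Q1 * Q2) = transpose_mat Q2 * transpose_mat Q1"
    by (rule transpose_mult[OF Q1 Q2])
  have "(P1 * P2) * X * transpose_mat (Q1 * Q2) = P1 * (P2 * X) * (transpose_mat Q2 * transpose_mat Q1)"
    unfolding t using assoc_mult_mat[OF P1 P2 X] by simp
  also have "\<dots> = P1 * (P2 * X) * transpose_mat Q2 * transpose_mat Q1"
    by (rule assoc_mult_mat[symmetric, of _ a d _ e _ f]) (use assms in auto)
  also have "P1 * (P2 * X) * transpose_mat Q2 = P1 * (P2 * X * transpose_mat Q2)"
    by (rule assoc_mult_mat[of _ a b _ d _ e]) (use assms in auto)
  finally show ?thesis .
qed

lemma orthonormal_columns_transpose_mult:
  assumes "Q \<in> carrier_mat m r" "orthonormal_columns Q"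
  shows "transpose_mat Q * Q = 1\<^sub>m r"
  using assms by (intro eq_matI) (auto simp: orthonormal_columns_def)

lemma upt_split: "a \<le> c \<Longrightarrow> c \<le> b \<Longrightarrow> [a..<b] = [a..<c] @ [c..<b]"
  by (metis le_add_diff_inverse upt_add_eq_append)

lemma append_eq_upt:
  assumes "xs @ ys = [a..<b]" "a \<le> b"
  obtains c where "a \<le> c" "c \<le> b" "xs = [a..<c]" "ys = [c..<b]"
proof
  let ?c = "a + length xs"
  have "length xs + length ys = b - a"
    using arg_cong[OF assms(1), of length] by simp
  then show c: "a \<le> ?c" "?c \<le> b" using assms(2) by simp_all
  show "xs = [a..<?c]" "ys = [?c..<b]"
    using assms(1) upt_split[OF c] append_eq_append_conv[of xs "[a..<?c]" ys "[?c..<b]"] by auto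
qed

lemma pick_atLeastLessThan:
  assumes "i < b - a"
  shows "pick {a..<b} i = a + i"
proof -
  have "{x \<in> {a..<b}. x < a + i} = {a..<a + i}" using assms by auto
  then show ?thesis using pick_card_in_set[of "a + i" "{a..<b}"] assms by simp
qed

lemma submatrix_atLeastLessThan:
  assumes "b \<le> dim_row A" "d \<le> dim_col A"
  shows "submatrix A {a..<b} {c..<d} = mat (b - a) (d - c) (\<lambda>(i, j). A $$ (a + i, c + j))"
proof -
  have "{i. i < dim_row A \<and> i \<in> {a..<b}} = {a..<b}" "{j. j < dim_col A \<and> j \<in> {c..<d}} = {c..<d}"
    using assms by auto
  then show ?thesis
    unfolding submatrix_def
    by (intro cong_mat) (simp_all add: pick_atLeastLessThan)
qed

lemma submatrix_split_interval:
  assumes "a \<le> c" "c \<le> b" "b \<le> dim_row A" "b \<le> dim_col A"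
  shows "submatrix A {a..<b} {a..<b} =
    four_block_mat (submatrix A {a..<c} {a..<c}) (submatrix A {a..<c} {c..<b})
                   (submatrix A {c..<b} {a..<c}) (submatrix A {c..<b} {c..<b})"
  using assms by (intro eq_matI) (auto simp: submatrix_atLeastLessThan ac_simps)

section \<open>Recursion on the height of a node\<close>

lemma lchild_in_nodes: "\<tau> \<in> nodes N \<Longrightarrow> depth \<tau> < N \<Longrightarrow> lchild \<tau> \<in> nodes N"
  and rchild_in_nodes: "\<tau> \<in> nodes N \<Longrightarrow> depth \<tau> < N \<Longrightarrow> rchild \<tau> \<in> nodes N"
  by (auto simp: nodes_def lchild_def rchild_def)

lemma depth_lchild [simp]: "depth (lchild \<tau>) = Suc (depth \<tau>)"
  and depth_rchild [simp]: "depth (rchild \<tau>) = Suc (depth \<tau>)"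
  by (simp_all add: lchild_def rchild_def)

lemma root_in_nodes [simp]: "root \<in> nodes N" and depth_root [simp]: "depth root = 0"
  by (simp_all add: nodes_def root_def)

lemma siblings_children:
  assumes "\<tau> \<in> nodes N" "depth \<tau> < N"
  shows "siblings N (lchild \<tau>) (rchild \<tau>)" "siblings N (rchild \<tau>) (lchild \<tau>)"
  using assms by (auto simp: siblings_def lchild_def rchild_def)

text \<open>
  The argument \<open>k\<close> in the next three functions is the number of levels below the node \<open>\<tau>\<close> that
  are taken into account, so the nodes of depth \<open>depth \<tau> + k\<close> are treated as leaves. Cutting off
  the deepest level of a tree amounts to passing from \<open>k + 1\<close> to \<open>k\<close>.

  The function \<open>subtree_diag\<close> is the part of \<open>level_diag\<close> that lies below \<open>\<tau>\<close>; its binary recursion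
  matches that of the tree.
\<close>

fun subtree_diag :: "(node \<Rightarrow> real mat) \<Rightarrow> nat \<Rightarrow> node \<Rightarrow> real mat" where
  "subtree_diag C 0 \<tau> = C \<tau>"
| "subtree_diag C (Suc k) \<tau> =
     diag_block_mat [subtree_diag C k (lchild \<tau>), subtree_diag C k (rchild \<tau>)]"

text \<open>
  If the leaves are \<open>k\<close> levels below \<open>\<tau>\<close>, this is \<open>Ubig \<tau>\<close> (or, with \<open>V\<close> in place of \<open>U\<close>,
  \<open>Vbig \<tau>\<close>), recovered from the transfer matrices.
\<close>

fun nested_basis :: "(node \<Rightarrow> real mat) \<Rightarrow> nat \<Rightarrow> node \<Rightarrow> real mat" where
  "nested_basis U 0 \<tau> = U \<tau>"
| "nested_basis U (Suc k) \<tau> =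
     diag_block_mat [nested_basis U k (lchild \<tau>), nested_basis U k (rchild \<tau>)] * U \<tau>"

text \<open>
  The diagonal block at \<open>\<tau>\<close> of the HSS matrix whose leaf blocks are the \<open>D\<close> of the nodes \<open>k\<close> levels
  below \<open>\<tau>\<close>.
\<close>

fun assemble ::
    "(node \<Rightarrow> real mat) \<Rightarrow> (node \<Rightarrow> real mat) \<Rightarrow> (node \<Rightarrow> node \<Rightarrow> real mat) \<Rightarrow>
     (node \<Rightarrow> real mat) \<Rightarrow> nat \<Rightarrow> node \<Rightarrow> real mat" where
  "assemble U V At D 0 \<tau> = D \<tau>"
| "assemble U V At D (Suc k) \<tau> =
     (let \<alpha> = lchild \<tau>; \<beta> = rchild \<tau> in
      four_block_mat
        (assemble U V At D k \<alpha>)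
        (nested_basis U k \<alpha> * At \<alpha> \<beta> * transpose_mat (nested_basis V k \<beta>))
        (nested_basis U k \<beta> * At \<beta> \<alpha> * transpose_mat (nested_basis V k \<alpha>))
        (assemble U V At D k \<beta>))"

text \<open>
  The nodes \<open>k\<close> levels below \<open>(l, i)\<close> are consecutive within their level, and the two children
  split their range in the middle.
\<close>

lemma subtree_diag_eq_diag_block_mat:
  "subtree_diag C k (l, i) = diag_block_mat (map (\<lambda>j. C (l + k, j)) [i * 2 ^ k..<(i + 1) * 2 ^ k])"
proof (induction k arbitrary: l i)
  case 0
  then show ?case by simp
next
  case (Suc k)
  let ?f = "\<lambda>j. C (l + Suc k, j)"
  have "[i * 2 ^ Suc k..<(i + 1) * 2 ^ Suc k] =
      [2 * i * 2 ^ k..<(2 * i + 1) * 2 ^ k] @ [(2 * i + 1) * 2 ^ k..<(2 * i + 1 + 1) * 2 ^ k]"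
    using upt_split[of "2 * i * 2 ^ k" "(2 * i + 1) * 2 ^ k" "(2 * i + 1 + 1) * 2 ^ k"]
    by (simp add: algebra_simps)
  then show ?case
    by (simp only: map_append diag_block_mat_append subtree_diag.simps diag_block_mat_pair
        lchild_def rchild_def Suc.IH Let_def)
      (simp add: add.commute mult.commute)
qed

lemma level_diag_eq_subtree_diag: "level_diag l C = subtree_diag C l root"
  unfolding level_diag_def root_def subtree_diag_eq_diag_block_mat by simp

section \<open>Generators of an HSS matrix\<close>

definition transfer_matrices ::
    "nat \<Rightarrow> nat \<Rightarrow> (node \<Rightarrow> nat) \<Rightarrow> (node \<Rightarrow> real mat) \<Rightarrow> bool" where
  "transfer_matrices N r s W \<longleftrightarrow> (\<forall>\<tau>\<in>nodes N. 1 \<le> depth \<tau> \<longrightarrow>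
     W \<tau> \<in> carrier_mat (if depth \<tau> = N then s \<tau> else 2 * r) r \<and> orthonormal_columns (W \<tau>))"

lemma transfer_matrices_leaf:
  assumes "transfer_matrices N r s W" "\<tau> \<in> nodes N" "1 \<le> depth \<tau>" "depth \<tau> = N"
  shows "W \<tau> \<in> carrier_mat (s \<tau>) r"
  using assms by (auto simp: transfer_matrices_def)

lemma transfer_matrices_inner:
  assumes "transfer_matrices N r s W" "\<tau> \<in> nodes N" "1 \<le> depth \<tau>" "depth \<tau> < N"
  shows "W \<tau> \<in> carrier_mat (2 * r) r"
  using assms unfolding transfer_matrices_def by (metis nat_neq_iff)

lemma transfer_matrices_orthonormal:
  assumes "transfer_matrices N r s W" "\<tau> \<in> nodes N" "1 \<le> depth \<tau>"
  shows "orthonormal_columns (W \<tau>)"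
  using assms by (auto simp: transfer_matrices_def)

text \<open>
  The conditions on the generators that are inherited when the deepest level of the tree is cut
  off. They speak of the sizes \<open>s\<close> of the index vectors and of arbitrary leaf blocks \<open>D\<close>, because
  after a cut the leaf blocks are no longer blocks of the original matrix.
\<close>

locale hss_generators =
  fixes N r :: nat and s :: "node \<Rightarrow> nat"
    and U V D :: "node \<Rightarrow> real mat" and At :: "node \<Rightarrow> node \<Rightarrow> real mat"
  assumes size_children:
      "\<And>\<tau>. \<tau> \<in> nodes N \<Longrightarrow> depth \<tau> < N \<Longrightarrow> s \<tau> = s (lchild \<tau>) + s (rchild \<tau>)"
    and U: "transfer_matrices N r s U"
    and V: "transfer_matrices N r s V"
    and At_children:
      "\<And>\<tau>. \<tau> \<in> nodes N \<Longrightarrow> depth \<tau> < N \<Longrightarrow> At (lchild \<tau>) (rchild \<tau>) \<in> carrier_mat r r"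
      "\<And>\<tau>. \<tau> \<in> nodes N \<Longrightarrow> depth \<tau> < N \<Longrightarrow> At (rchild \<tau>) (lchild \<tau>) \<in> carrier_mat r r"
    and D_leaf: "\<And>\<tau>. \<tau> \<in> nodes N \<Longrightarrow> depth \<tau> = N \<Longrightarrow> D \<tau> \<in> carrier_mat (s \<tau>) (s \<tau>)"
    and D_inner: "\<And>\<tau>. \<tau> \<in> nodes N \<Longrightarrow> depth \<tau> < N \<Longrightarrow>
      D \<tau> = four_block_mat (0\<^sub>m r r) (At (lchild \<tau>) (rchild \<tau>))
                           (At (rchild \<tau>) (lchild \<tau>)) (0\<^sub>m r r)"
begin

lemma D_inner_carrier:
  assumes "\<tau> \<in> nodes N" "depth \<tau> < N"
  shows "D \<tau> \<in> carrier_mat (2 * r) (2 * r)"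
  unfolding D_inner[OF assms] mult_2 by simp

lemma assemble_carrier:
  "\<tau> \<in> nodes N \<Longrightarrow> depth \<tau> + k = N \<Longrightarrow> assemble U V At D k \<tau> \<in> carrier_mat (s \<tau>) (s \<tau>)"
proof (induction k arbitrary: \<tau>)
  case 0
  then show ?case using D_leaf by simp
next
  case (Suc k)
  then have "assemble U V At D k (lchild \<tau>) \<in> carrier_mat (s (lchild \<tau>)) (s (lchild \<tau>))"
    "assemble U V At D k (rchild \<tau>) \<in> carrier_mat (s (rchild \<tau>)) (s (rchild \<tau>))"
    by (auto intro!: Suc.IH lchild_in_nodes rchild_in_nodes)
  then show ?case
    using size_children[of \<tau>] Suc.prems by (auto simp: Let_def)
qed

lemma subtree_diag_basis_carrier:
  assumes W: "transfer_matrices N r s W"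
  shows "\<tau> \<in> nodes N \<Longrightarrow> 1 \<le> N \<Longrightarrow> depth \<tau> + k = N \<Longrightarrow>
    subtree_diag W k \<tau> \<in> carrier_mat (s \<tau>) (2 ^ k * r)"
proof (induction k arbitrary: \<tau>)
  case 0
  then show ?case using transfer_matrices_leaf[OF W, of \<tau>] by simp
next
  case (Suc k)
  have "diag_block_mat [subtree_diag W k (lchild \<tau>), subtree_diag W k (rchild \<tau>)]
      \<in> carrier_mat (s (lchild \<tau>) + s (rchild \<tau>)) (2 ^ k * r + 2 ^ k * r)"
    using Suc by (intro diag_block_mat_pair_carrier Suc.IH lchild_in_nodes rchild_in_nodes) auto
  then show ?case
    using size_children[of \<tau>] Suc.prems by (simp add: mult_2 algebra_simps)
qed

lemma subtree_diag_orthonormal: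
  assumes W: "transfer_matrices N r s W"
  shows "\<tau> \<in> nodes N \<Longrightarrow> 1 \<le> N \<Longrightarrow> depth \<tau> + k = N \<Longrightarrow>
    transpose_mat (subtree_diag W k \<tau>) * subtree_diag W k \<tau> = 1\<^sub>m (2 ^ k * r)"
proof (induction k arbitrary: \<tau>)
  case 0
  then show ?case
    using orthonormal_columns_transpose_mult[of "W \<tau>" "s \<tau>" r]
      transfer_matrices_leaf[OF W, of \<tau>] transfer_matrices_orthonormal[OF W, of \<tau>] by simp
next
  case (Suc k)
  let ?A = "subtree_diag W k (lchild \<tau>)" and ?B = "subtree_diag W k (rchild \<tau>)"
  have nodes: "lchild \<tau> \<in> nodes N" "rchild \<tau> \<in> nodes N"
    using Suc.prems by (auto intro: lchild_in_nodes rchild_in_nodes)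
  have c: "?A \<in> carrier_mat (s (lchild \<tau>)) (2 ^ k * r)" "?B \<in> carrier_mat (s (rchild \<tau>)) (2 ^ k * r)"
    using subtree_diag_basis_carrier[OF W nodes(1)] subtree_diag_basis_carrier[OF W nodes(2)] Suc.prems
    by auto
  have "diag_block_mat [transpose_mat ?A, transpose_mat ?B] * diag_block_mat [?A, ?B] =
      diag_block_mat [transpose_mat ?A * ?A, transpose_mat ?B * ?B]"
    by (rule diag_block_mat_pair_mult) (use c in auto)
  also have "\<dots> = diag_block_mat [1\<^sub>m (2 ^ k * r), 1\<^sub>m (2 ^ k * r)]"
    using Suc.IH[OF nodes(1)] Suc.IH[OF nodes(2)] Suc.prems by simp
  also have "\<dots> = 1\<^sub>m (2 ^ Suc k * r)"
    unfolding diag_block_mat_pair by (simp add: mult_2 algebra_simps)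
  finally show ?case
    by (simp only: subtree_diag.simps transpose_diag_block_mat_pair)
qed

lemma subtree_diag_D_carrier:
  "\<tau> \<in> nodes N \<Longrightarrow> depth \<tau> + k = N \<Longrightarrow> subtree_diag D k \<tau> \<in> carrier_mat (s \<tau>) (s \<tau>)"
proof (induction k arbitrary: \<tau>)
  case 0
  then show ?case using D_leaf by simp
next
  case (Suc k)
  have "diag_block_mat [subtree_diag D k (lchild \<tau>), subtree_diag D k (rchild \<tau>)]
      \<in> carrier_mat (s (lchild \<tau>) + s (rchild \<tau>)) (s (lchild \<tau>) + s (rchild \<tau>))"
    using Suc by (intro diag_block_mat_pair_carrier Suc.IH lchild_in_nodes rchild_in_nodes) auto
  then show ?case
    using size_children[of \<tau>] Suc.prems by simp
qed

text \<open>
  Associativity alone: the leaf matrices are the outermost factors of a nested basis, and the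
  remaining factors form the nested basis of the tree without its deepest level.
\<close>

lemma nested_basis_peel:
  assumes W: "transfer_matrices N r s W"
  shows "\<tau> \<in> nodes N \<Longrightarrow> 1 \<le> depth \<tau> \<Longrightarrow> depth \<tau> + Suc k = N \<Longrightarrow>
    nested_basis W k \<tau> \<in> carrier_mat (2 ^ Suc k * r) r \<and>
    nested_basis W (Suc k) \<tau> = subtree_diag W (Suc k) \<tau> * nested_basis W k \<tau>"
proof (induction k arbitrary: \<tau>)
  case 0
  then show ?case using transfer_matrices_inner[OF W, of \<tau>] by simp
next
  case (Suc k)
  let ?n = "2 ^ Suc k * r"
  let ?a = "nested_basis W k (lchild \<tau>)" and ?b = "nested_basis W k (rchild \<tau>)"
  let ?A = "subtree_diag W (Suc k) (lchild \<tau>)" and ?B = "subtree_diag W (Suc k) (rchild \<tau>)"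
  have nodes: "lchild \<tau> \<in> nodes N" "rchild \<tau> \<in> nodes N"
    using Suc.prems by (auto intro: lchild_in_nodes rchild_in_nodes)
  have IH: "?a \<in> carrier_mat ?n r" "nested_basis W (Suc k) (lchild \<tau>) = ?A * ?a"
      "?b \<in> carrier_mat ?n r" "nested_basis W (Suc k) (rchild \<tau>) = ?B * ?b"
    using Suc.IH[OF nodes(1)] Suc.IH[OF nodes(2)] Suc.prems by auto
  have c: "?A \<in> carrier_mat (s (lchild \<tau>)) ?n" "?B \<in> carrier_mat (s (rchild \<tau>)) ?n"
    using subtree_diag_basis_carrier[OF W nodes(1), of "Suc k"]
      subtree_diag_basis_carrier[OF W nodes(2), of "Suc k"] Suc.prems
    by (auto simp del: subtree_diag.simps)
  have W: "W \<tau> \<in> carrier_mat (r + r) r"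
    using transfer_matrices_inner[OF W, of \<tau>] Suc.prems by (simp add: mult_2)
  have ab: "diag_block_mat [?a, ?b] \<in> carrier_mat (?n + ?n) (r + r)"
    and AB: "diag_block_mat [?A, ?B] \<in> carrier_mat (s (lchild \<tau>) + s (rchild \<tau>)) (?n + ?n)"
    using diag_block_mat_pair_carrier IH c by blast+
  have "nested_basis W (Suc (Suc k)) \<tau> = diag_block_mat [?A * ?a, ?B * ?b] * W \<tau>"
    by (subst nested_basis.simps(2)) (simp only: IH)
  also have "\<dots> = diag_block_mat [?A, ?B] * (diag_block_mat [?a, ?b] * W \<tau>)"
    unfolding diag_block_mat_pair_mult[OF c IH(1,3), symmetric] using AB ab W by (rule assoc_mult_mat)
  also have "\<dots> = subtree_diag W (Suc (Suc k)) \<tau> * nested_basis W (Suc k) \<tau>"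
    by (simp only: subtree_diag.simps(2) nested_basis.simps(2))
  finally show ?case
    using mult_carrier_mat[OF ab W] by (simp add: mult_2 algebra_simps)
qed

text \<open>
  The cut-off identity, by induction on the height. At height one, the two off-diagonal blocks are
  \<open>U \<alpha> * At \<alpha> \<beta> * (V \<beta>)\<^sup>T\<close> and its mirror image, which is exactly what \<open>D \<tau>\<close> becomes
  between the block diagonal leaf bases. Higher up, the diagonal blocks are handled by the induction
  hypothesis and the off-diagonal ones by \<open>nested_basis_peel\<close>. The dimension is part of the
  induction because \<open>H k\<close> has the size of the reduced tree, not that of the given one.
\<close>

lemma assemble_peel:
  "\<tau> \<in> nodes N \<Longrightarrow> depth \<tau> + Suc k = N \<Longrightarrow>
    assemble U V At D k \<tau> \<in> carrier_mat (2 ^ Suc k * r) (2 ^ Suc k * r) \<and>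
    assemble U V At D (Suc k) \<tau> = subtree_diag D (Suc k) \<tau> +
      subtree_diag U (Suc k) \<tau> * assemble U V At D k \<tau> * transpose_mat (subtree_diag V (Suc k) \<tau>)"
proof (induction k arbitrary: \<tau>)
  case 0
  let ?\<alpha> = "lchild \<tau>" and ?\<beta> = "rchild \<tau>"
  have nodes: "?\<alpha> \<in> nodes N" "?\<beta> \<in> nodes N" and d: "depth ?\<alpha> = N" "depth ?\<beta> = N"
    using 0 by (auto intro: lchild_in_nodes rchild_in_nodes)
  have c: "U ?\<alpha> \<in> carrier_mat (s ?\<alpha>) r" "U ?\<beta> \<in> carrier_mat (s ?\<beta>) r"
      "V ?\<alpha> \<in> carrier_mat (s ?\<alpha>) r" "V ?\<beta> \<in> carrier_mat (s ?\<beta>) r"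
      "D ?\<alpha> \<in> carrier_mat (s ?\<alpha>) (s ?\<alpha>)" "D ?\<beta> \<in> carrier_mat (s ?\<beta>) (s ?\<beta>)"
    using nodes d D_leaf transfer_matrices_leaf[OF U] transfer_matrices_leaf[OF V] 0
    by (auto simp del: One_nat_def)
  have At: "At ?\<alpha> ?\<beta> \<in> carrier_mat r r" "At ?\<beta> ?\<alpha> \<in> carrier_mat r r"
    using At_children 0 by auto
  have D\<tau>: "D \<tau> = four_block_mat (0\<^sub>m r r) (At ?\<alpha> ?\<beta>) (At ?\<beta> ?\<alpha>) (0\<^sub>m r r)"
    using D_inner 0 by simp
  have "diag_block_mat [U ?\<alpha>, U ?\<beta>] * D \<tau> * transpose_mat (diag_block_mat [V ?\<alpha>, V ?\<beta>]) =
      four_block_mat (U ?\<alpha> * 0\<^sub>m r r * transpose_mat (V ?\<alpha>)) (U ?\<alpha> * At ?\<alpha> ?\<beta> * transpose_mat (V ?\<beta>))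
        (U ?\<beta> * At ?\<beta> ?\<alpha> * transpose_mat (V ?\<alpha>)) (U ?\<beta> * 0\<^sub>m r r * transpose_mat (V ?\<beta>))"
    unfolding D\<tau> by (rule diag_block_mat_pair_sandwich) (use c At in auto)
  also have "diag_block_mat [D ?\<alpha>, D ?\<beta>] + \<dots> = assemble U V At D 1 \<tau>"
    unfolding diag_block_mat_pair_eq[OF c(5,6)]
    by (subst add_four_block_mat[OF c(5) _ _ c(6)])
      (use c At in \<open>auto simp: Let_def intro!: cong_four_block_mat\<close>)
  finally show ?case
    using D_inner_carrier[of \<tau>] 0 by simp
next
  case (Suc k)
  let ?\<alpha> = "lchild \<tau>" and ?\<beta> = "rchild \<tau>" and ?n = "2 ^ Suc k * r"
  let ?H = "assemble U V At D" and ?u = "nested_basis U" and ?v = "nested_basis V"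
  let ?DD = "subtree_diag D (Suc k)" and ?UU = "subtree_diag U (Suc k)"
    and ?VV = "subtree_diag V (Suc k)"
  have nodes: "?\<alpha> \<in> nodes N" "?\<beta> \<in> nodes N"
    and d: "depth ?\<alpha> + Suc k = N" "depth ?\<beta> + Suc k = N" "1 \<le> depth ?\<alpha>" "1 \<le> depth ?\<beta>"
    using Suc.prems by (auto intro: lchild_in_nodes rchild_in_nodes)
  have IH: "?H k ?\<alpha> \<in> carrier_mat ?n ?n" "?H k ?\<beta> \<in> carrier_mat ?n ?n"
      "?H (Suc k) ?\<alpha> = ?DD ?\<alpha> + ?UU ?\<alpha> * ?H k ?\<alpha> * transpose_mat (?VV ?\<alpha>)"
      "?H (Suc k) ?\<beta> = ?DD ?\<beta> + ?UU ?\<beta> * ?H k ?\<beta> * transpose_mat (?VV ?\<beta>)"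
    using Suc.IH[OF nodes(1) d(1)] Suc.IH[OF nodes(2) d(2)] by auto
  have N: "1 \<le> N" using d by simp
  have c: "?UU ?\<alpha> \<in> carrier_mat (s ?\<alpha>) ?n" "?UU ?\<beta> \<in> carrier_mat (s ?\<beta>) ?n"
      "?VV ?\<alpha> \<in> carrier_mat (s ?\<alpha>) ?n" "?VV ?\<beta> \<in> carrier_mat (s ?\<beta>) ?n"
    using subtree_diag_basis_carrier[OF U nodes(1) N d(1)]
      subtree_diag_basis_carrier[OF U nodes(2) N d(2)]
      subtree_diag_basis_carrier[OF V nodes(1) N d(1)]
      subtree_diag_basis_carrier[OF V nodes(2) N d(2)] by blast+
  have cD: "?DD ?\<alpha> \<in> carrier_mat (s ?\<alpha>) (s ?\<alpha>)" "?DD ?\<beta> \<in> carrier_mat (s ?\<beta>) (s ?\<beta>)"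
    using subtree_diag_D_carrier nodes d by blast+
  have u: "?u k ?\<alpha> \<in> carrier_mat ?n r" "?u k ?\<beta> \<in> carrier_mat ?n r"
      "?v k ?\<alpha> \<in> carrier_mat ?n r" "?v k ?\<beta> \<in> carrier_mat ?n r"
    and peel: "?u (Suc k) ?\<alpha> = ?UU ?\<alpha> * ?u k ?\<alpha>" "?u (Suc k) ?\<beta> = ?UU ?\<beta> * ?u k ?\<beta>"
      "?v (Suc k) ?\<alpha> = ?VV ?\<alpha> * ?v k ?\<alpha>" "?v (Suc k) ?\<beta> = ?VV ?\<beta> * ?v k ?\<beta>"
    using nested_basis_peel[OF U nodes(1) d(3,1)] nested_basis_peel[OF U nodes(2) d(4,2)]
      nested_basis_peel[OF V nodes(1) d(3,1)] nested_basis_peel[OF V nodes(2) d(4,2)] by blast+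
  have At: "At ?\<alpha> ?\<beta> \<in> carrier_mat r r" "At ?\<beta> ?\<alpha> \<in> carrier_mat r r"
    using At_children Suc.prems by auto
  let ?X12 = "?u k ?\<alpha> * At ?\<alpha> ?\<beta> * transpose_mat (?v k ?\<beta>)"
    and ?X21 = "?u k ?\<beta> * At ?\<beta> ?\<alpha> * transpose_mat (?v k ?\<alpha>)"
  have X: "?X12 \<in> carrier_mat ?n ?n" "?X21 \<in> carrier_mat ?n ?n"
    using u At by auto
  have Hk: "?H (Suc k) \<tau> = four_block_mat (?H k ?\<alpha>) ?X12 ?X21 (?H k ?\<beta>)"
    by (simp add: Let_def)
  have off: "?u (Suc k) ?\<alpha> * At ?\<alpha> ?\<beta> * transpose_mat (?v (Suc k) ?\<beta>) =
        ?UU ?\<alpha> * ?X12 * transpose_mat (?VV ?\<beta>)"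
      "?u (Suc k) ?\<beta> * At ?\<beta> ?\<alpha> * transpose_mat (?v (Suc k) ?\<alpha>) =
        ?UU ?\<beta> * ?X21 * transpose_mat (?VV ?\<alpha>)"
    unfolding peel
    using mult_sandwich_assoc[OF c(1) u(1) At(1) u(4) c(4)]
      mult_sandwich_assoc[OF c(2) u(2) At(2) u(3) c(3)] by blast+
  let ?Y = "\<lambda>\<sigma> X \<sigma>'. ?UU \<sigma> * X * transpose_mat (?VV \<sigma>')"
  have Y: "?Y ?\<alpha> ?X12 ?\<beta> \<in> carrier_mat (s ?\<alpha>) (s ?\<beta>)" "?Y ?\<beta> ?X21 ?\<alpha> \<in> carrier_mat (s ?\<beta>) (s ?\<alpha>)"
      "?Y ?\<alpha> (?H k ?\<alpha>) ?\<alpha> \<in> carrier_mat (s ?\<alpha>) (s ?\<alpha>)" "?Y ?\<beta> (?H k ?\<beta>) ?\<beta> \<in> carrier_mat (s ?\<beta>) (s ?\<beta>)"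
    using mult_carrier_mat[OF mult_carrier_mat[OF c(1) X(1)], of "transpose_mat (?VV ?\<beta>)" "s ?\<beta>"]
      mult_carrier_mat[OF mult_carrier_mat[OF c(2) X(2)], of "transpose_mat (?VV ?\<alpha>)" "s ?\<alpha>"]
      mult_carrier_mat[OF mult_carrier_mat[OF c(1) IH(1)], of "transpose_mat (?VV ?\<alpha>)" "s ?\<alpha>"]
      mult_carrier_mat[OF mult_carrier_mat[OF c(2) IH(2)], of "transpose_mat (?VV ?\<beta>)" "s ?\<beta>"]
      c(3,4) by (simp_all only: transpose_carrier_mat)
  have "subtree_diag D (Suc (Suc k)) \<tau> + subtree_diag U (Suc (Suc k)) \<tau> * ?H (Suc k) \<tau> *
        transpose_mat (subtree_diag V (Suc (Suc k)) \<tau>) =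
      diag_block_mat [?DD ?\<alpha>, ?DD ?\<beta>] +
      four_block_mat (?Y ?\<alpha> (?H k ?\<alpha>) ?\<alpha>) (?Y ?\<alpha> ?X12 ?\<beta>) (?Y ?\<beta> ?X21 ?\<alpha>) (?Y ?\<beta> (?H k ?\<beta>) ?\<beta>)"
    unfolding Hk subtree_diag.simps(2)[of _ "Suc k"]
    using diag_block_mat_pair_sandwich[OF c IH(1) X IH(2)] by simp
  also have "\<dots> = four_block_mat (?DD ?\<alpha> + ?Y ?\<alpha> (?H k ?\<alpha>) ?\<alpha>) (0\<^sub>m (s ?\<alpha>) (s ?\<beta>) + ?Y ?\<alpha> ?X12 ?\<beta>)
      (0\<^sub>m (s ?\<beta>) (s ?\<alpha>) + ?Y ?\<beta> ?X21 ?\<alpha>) (?DD ?\<beta> + ?Y ?\<beta> (?H k ?\<beta>) ?\<beta>)"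
    unfolding diag_block_mat_pair_eq[OF cD]
    by (rule add_four_block_mat[OF cD(1) zero_carrier_mat zero_carrier_mat cD(2) Y(3,1,2,4)])
  also have "\<dots> = ?H (Suc (Suc k)) \<tau>"
    unfolding assemble.simps(2)[of _ _ _ _ "Suc k"] Let_def off IH(3,4)
      left_add_zero_mat[OF Y(1)] left_add_zero_mat[OF Y(2)] ..
  finally have eq: "?H (Suc (Suc k)) \<tau> = subtree_diag D (Suc (Suc k)) \<tau> +
      subtree_diag U (Suc (Suc k)) \<tau> * ?H (Suc k) \<tau> *
        transpose_mat (subtree_diag V (Suc (Suc k)) \<tau>)" ..
  have "?H (Suc k) \<tau> \<in> carrier_mat (?n + ?n) (?n + ?n)"
    unfolding Hk by (rule four_block_carrier_mat[OF IH(1,2)])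
  then have "?H (Suc k) \<tau> \<in> carrier_mat (2 ^ Suc (Suc k) * r) (2 ^ Suc (Suc k) * r)"
    by (simp only: power_Suc mult_2 mult.assoc distrib_right)
  with eq show ?case by blast
qed

lemma hss_generators_telescopic_dims:
  assumes "\<And>\<tau>. \<tau> \<in> nodes N \<Longrightarrow> length (I \<tau>) = s \<tau>"
  shows "telescopic_dims N I r U V D"
  unfolding telescopic_dims_def Let_def
proof (intro ballI conjI impI)
  fix \<tau> assume \<tau>: "\<tau> \<in> nodes N"
  then have le: "depth \<tau> \<le> N" by (auto simp: nodes_def)
  show "D \<tau> \<in> carrier_mat (if depth \<tau> = N then length (I \<tau>) else 2 * r)
      (if depth \<tau> = N then length (I \<tau>) else 2 * r)"
    using \<tau> le assms D_leaf D_inner_carrier by auto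
  assume 1: "1 \<le> depth \<tau>"
  show "U \<tau> \<in> carrier_mat (if depth \<tau> = N then length (I \<tau>) else 2 * r) r"
    "V \<tau> \<in> carrier_mat (if depth \<tau> = N then length (I \<tau>) else 2 * r) r"
    "orthonormal_columns (U \<tau>)" "orthonormal_columns (V \<tau>)"
    using \<tau> 1 assms U V by (auto simp: transfer_matrices_def)
qed

end

lemma length_balanced_tree: "length (balanced_tree m k \<tau>) = 2 ^ (k - depth \<tau>) * m"
  by (simp add: balanced_tree_def algebra_simps)

text \<open>
  The nodes of depth \<open>K\<close> were inner nodes before the cut, so all their matrices already have
  \<open>2 * r\<close> rows, which is the size of a leaf of the balanced tree.
\<close>

lemma hss_generators_reduce:
  assumes "hss_generators (Suc K) r s U V D At"
  shows "hss_generators K r (\<lambda>\<tau>. length (balanced_tree (2 * r) K \<tau>)) U V D At"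
proof -
  interpret hss_generators "Suc K" r s U V D At by fact
  have up: "\<tau> \<in> nodes (Suc K)" "depth \<tau> < Suc K" if "\<tau> \<in> nodes K" for \<tau>
    using that by (auto simp: nodes_def)
  have W: "transfer_matrices K r (\<lambda>\<tau>. length (balanced_tree (2 * r) K \<tau>)) W"
    if "transfer_matrices (Suc K) r s W" for W
    unfolding transfer_matrices_def
  proof (intro ballI impI)
    fix \<tau> assume \<tau>: "\<tau> \<in> nodes K" "1 \<le> depth \<tau>"
    show "W \<tau> \<in> carrier_mat (if depth \<tau> = K then length (balanced_tree (2 * r) K \<tau>) else 2 * r) r \<and>
        orthonormal_columns (W \<tau>)"
      using transfer_matrices_inner[OF that up(1)[OF \<tau>(1)] \<tau>(2) up(2)[OF \<tau>(1)]]
        transfer_matrices_orthonormal[OF that up(1)[OF \<tau>(1)] \<tau>(2)]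
      by (simp add: length_balanced_tree)
  qed
  show ?thesis
  proof
    fix \<tau> :: node
    assume \<tau>: "\<tau> \<in> nodes K" "depth \<tau> < K"
    have "K - depth \<tau> = Suc (K - Suc (depth \<tau>))" using \<tau> by simp
    then show "length (balanced_tree (2 * r) K \<tau>) =
        length (balanced_tree (2 * r) K (lchild \<tau>)) + length (balanced_tree (2 * r) K (rchild \<tau>))"
      by (simp add: length_balanced_tree)
  next
    fix \<tau> :: node
    assume "\<tau> \<in> nodes K" "depth \<tau> = K"
    then show "D \<tau> \<in> carrier_mat (length (balanced_tree (2 * r) K \<tau>))
        (length (balanced_tree (2 * r) K \<tau>))"
      using D_inner_carrier[OF up] by (simp add: length_balanced_tree)
  qed (use up U V W At_children D_inner in auto)
qed

text \<open>
  Orthonormality of the leaf bases determines the middle factor of the telescopic identity.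
\<close>

lemma compress_sandwich:
  fixes P :: "'a :: comm_ring_1 mat"
  assumes P: "P \<in> carrier_mat m n" "transpose_mat P * P = 1\<^sub>m n"
    and Q: "Q \<in> carrier_mat m n" "transpose_mat Q * Q = 1\<^sub>m n"
    and X: "X \<in> carrier_mat n n" and E: "E \<in> carrier_mat m m"
  shows "transpose_mat P * (E + P * X * transpose_mat Q - E) * Q = X"
proof -
  have Y: "P * X * transpose_mat Q \<in> carrier_mat m m" using P Q X by auto
  have cancel: "E + Z - E = Z" if "Z \<in> carrier_mat m m" for Z
    using E that by (intro eq_matI) auto
  have "E + P * X * transpose_mat Q - E = P * X * transpose_mat Q"
    by (rule cancel[OF Y])
  also have "\<dots> = P * (X * transpose_mat Q)"
    by (rule assoc_mult_mat) (use P Q X in auto)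
  also have "transpose_mat P * \<dots> = (transpose_mat P * P) * (X * transpose_mat Q)"
    by (rule assoc_mult_mat[symmetric]) (use P Q X in auto)
  also have "\<dots> = X * transpose_mat Q"
    unfolding P(2) by (rule left_mult_one_mat) (use Q X in auto)
  also have "X * transpose_mat Q * Q = X * (transpose_mat Q * Q)"
    by (rule assoc_mult_mat) (use Q X in auto)
  also have "\<dots> = X"
    unfolding Q(2) by (rule right_mult_one_mat) (use X in auto)
  finally show ?thesis .
qed

text \<open>
  The index vectors must vary in the induction: after the first step they come from a balanced
  tree. The generators and \<open>D\<close> stay the same at every level.
\<close>

lemma telescopic_decomposition_assemble:
  assumes "hss_generators N r (\<lambda>\<tau>. length (I \<tau>)) U V D At"
  shows "telescopic_decomposition N I r U V D (assemble U V At D N root)"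
  using assms
proof (induction N arbitrary: I)
  case 0
  interpret hss_generators 0 r "\<lambda>\<tau>. length (I \<tau>)" U V D At by fact
  show ?case
    using hss_generators_telescopic_dims[of I] D_leaf[of root] by simp
next
  case (Suc K)
  interpret hss_generators "Suc K" r "\<lambda>\<tau>. length (I \<tau>)" U V D At by fact
  let ?H = "assemble U V At D" and ?D = "subtree_diag D (Suc K) root"
    and ?U = "subtree_diag U (Suc K) root" and ?V = "subtree_diag V (Suc K) root"
  have IH: "telescopic_decomposition K (balanced_tree (2 * r) K) r U V D (?H K root)"
    using Suc.IH hss_generators_reduce[OF Suc.prems] by blast
  have peel: "?H K root \<in> carrier_mat (2 ^ Suc K * r) (2 ^ Suc K * r)"
      "?H (Suc K) root = ?D + ?U * ?H K root * transpose_mat ?V"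
    using assemble_peel[of root K] by auto
  have c: "?U \<in> carrier_mat (length (I root)) (2 ^ Suc K * r)"
      "?V \<in> carrier_mat (length (I root)) (2 ^ Suc K * r)"
      "?D \<in> carrier_mat (length (I root)) (length (I root))"
    using subtree_diag_basis_carrier[OF U, of root "Suc K"]
      subtree_diag_basis_carrier[OF V, of root "Suc K"] subtree_diag_D_carrier[of root "Suc K"]
    by auto
  have o: "transpose_mat ?U * ?U = 1\<^sub>m (2 ^ Suc K * r)" "transpose_mat ?V * ?V = 1\<^sub>m (2 ^ Suc K * r)"
    using subtree_diag_orthonormal[OF U, of root "Suc K"]
      subtree_diag_orthonormal[OF V, of root "Suc K"] by auto
  have A': "transpose_mat ?U * (?H (Suc K) root - ?D) * ?V = ?H K root"
    unfolding peel(2) by (rule compress_sandwich[OF c(1) o(1) c(2) o(2) peel(1) c(3)])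
  have dims: "telescopic_dims (Suc K) I r U V D"
    by (rule hss_generators_telescopic_dims) simp
  have carrier: "?H (Suc K) root \<in> carrier_mat (length (I root)) (length (I root))"
    using assemble_carrier[of root "Suc K"] by simp
  show ?case
    unfolding telescopic_decomposition.simps(2) level_diag_eq_subtree_diag Let_def A'
    using carrier dims peel(2) IH by blast
qed

section \<open>Every HSS matrix is assembled from its generators\<close>

text \<open>
  By induction from the root: a concatenation of two lists is an interval only if both are.
\<close>

lemma cluster_tree_interval:
  assumes "cluster_tree n L I"
  shows "l \<le> L \<Longrightarrow> i < 2 ^ l \<Longrightarrow> \<exists>a b. I (l, i) = [a..<b] \<and> a \<le> b \<and> b \<le> n"
proof (induction l arbitrary: i)
  case 0
  then show ?case using assms by (auto simp: cluster_tree_def root_def)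
next
  case (Suc l)
  let ?\<rho> = "(l, i div 2)"
  obtain a b where ab: "I ?\<rho> = [a..<b]" "a \<le> b" "b \<le> n"
    using Suc.IH[of "i div 2"] Suc.prems by (auto simp: less_mult_imp_div_less mult.commute)
  have "I (lchild ?\<rho>) @ I (rchild ?\<rho>) = [a..<b]"
    using assms Suc.prems ab(1) by (auto simp: cluster_tree_def nodes_def)
  then obtain c where "a \<le> c" "c \<le> b" "I (lchild ?\<rho>) = [a..<c]" "I (rchild ?\<rho>) = [c..<b]"
    using ab(2) by (rule append_eq_upt)
  moreover have "(Suc l, i) = lchild ?\<rho> \<or> (Suc l, i) = rchild ?\<rho>"
    unfolding lchild_def rchild_def by auto
  ultimately have "I (Suc l, i) = [a..<c] \<or> I (Suc l, i) = [c..<b]"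
    by metis
  moreover have "c \<le> n" using \<open>c \<le> b\<close> ab(3) by simp
  ultimately show ?case
    using \<open>a \<le> c\<close> \<open>c \<le> b\<close> ab(3) by blast
qed

lemma cluster_block_split:
  assumes "cluster_tree n L I" "A \<in> carrier_mat n n" "\<tau> \<in> nodes L" "depth \<tau> < L"
  shows "cluster_block I A \<tau> \<tau> =
    four_block_mat (cluster_block I A (lchild \<tau>) (lchild \<tau>)) (cluster_block I A (lchild \<tau>) (rchild \<tau>))
      (cluster_block I A (rchild \<tau>) (lchild \<tau>)) (cluster_block I A (rchild \<tau>) (rchild \<tau>))"
proof -
  have I: "I \<tau> = I (lchild \<tau>) @ I (rchild \<tau>)"
    using assms by (auto simp: cluster_tree_def)
  obtain l i where li: "\<tau> = (l, i)" by fastforce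
  obtain a b where ab: "I \<tau> = [a..<b]" "a \<le> b" "b \<le> n"
    using cluster_tree_interval[OF assms(1), of l i] assms(3) by (auto simp: li nodes_def)
  have "I (lchild \<tau>) @ I (rchild \<tau>) = [a..<b]"
    using I ab(1) by simp
  then obtain c where c: "a \<le> c" "c \<le> b" "I (lchild \<tau>) = [a..<c]" "I (rchild \<tau>) = [c..<b]"
    using ab(2) by (rule append_eq_upt)
  show ?thesis
    unfolding cluster_block_def ab(1) c(3,4) set_upt
    by (rule submatrix_split_interval) (use c(1,2) ab(3) assms(2) in auto)
qed

lemma big_basis_eq_nested_basis:
  assumes leaf: "\<And>\<tau>. \<tau> \<in> nodes L \<Longrightarrow> 1 \<le> depth \<tau> \<Longrightarrow> depth \<tau> = L \<Longrightarrow> W \<tau> = Wbig \<tau>"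
    and inner: "\<And>\<tau>. \<tau> \<in> nodes L \<Longrightarrow> 1 \<le> depth \<tau> \<Longrightarrow> depth \<tau> < L \<Longrightarrow>
      Wbig \<tau> = diag_block_mat [Wbig (lchild \<tau>), Wbig (rchild \<tau>)] * W \<tau>"
  shows "\<tau> \<in> nodes L \<Longrightarrow> 1 \<le> depth \<tau> \<Longrightarrow> depth \<tau> + k = L \<Longrightarrow> Wbig \<tau> = nested_basis W k \<tau>"
proof (induction k arbitrary: \<tau>)
  case 0
  then show ?case using leaf by simp
next
  case (Suc k)
  then have "Wbig (lchild \<tau>) = nested_basis W k (lchild \<tau>)" "Wbig (rchild \<tau>) = nested_basis W k (rchild \<tau>)"
    by (auto intro!: Suc.IH lchild_in_nodes rchild_in_nodes)
  then show ?case using inner[of \<tau>] Suc.prems by simp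
qed

text \<open>
  By induction from the leaves: the diagonal block of a node splits into the diagonal blocks of the
  children and the two sibling blocks, which have the low-rank form of \<open>assemble\<close> once the large
  bases are written as nested bases.
\<close>

lemma cluster_block_eq_assemble:
  assumes "cluster_tree n L I" "A \<in> carrier_mat n n"
    and hss: "hss_conditions L I r A Ubig Vbig At U V"
    and leaf: "\<And>\<tau>. \<tau> \<in> nodes L \<Longrightarrow> 1 \<le> depth \<tau> \<Longrightarrow> depth \<tau> = L \<Longrightarrow> U \<tau> = Ubig \<tau> \<and> V \<tau> = Vbig \<tau>"
    and D: "\<And>\<tau>. \<tau> \<in> nodes L \<Longrightarrow> depth \<tau> = L \<Longrightarrow> D \<tau> = cluster_block I A \<tau> \<tau>"
  shows "\<tau> \<in> nodes L \<Longrightarrow> depth \<tau> + k = L \<Longrightarrow> cluster_block I A \<tau> \<tau> = assemble U V At D k \<tau>"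
proof (induction k arbitrary: \<tau>)
  case 0
  then show ?case using D by simp
next
  case (Suc k)
  let ?\<alpha> = "lchild \<tau>" and ?\<beta> = "rchild \<tau>"
  have \<tau>: "depth \<tau> < L" using Suc.prems by simp
  have nodes: "?\<alpha> \<in> nodes L" "?\<beta> \<in> nodes L"
    using Suc.prems by (auto intro: lchild_in_nodes rchild_in_nodes)
  have big: "Ubig \<sigma> = nested_basis U k \<sigma>" "Vbig \<sigma> = nested_basis V k \<sigma>" if "\<sigma> \<in> {?\<alpha>, ?\<beta>}" for \<sigma>
    using that nodes Suc.prems leaf hss
    by (auto intro!: big_basis_eq_nested_basis[of L] simp: hss_conditions_def)
  have off: "cluster_block I A \<sigma> \<sigma>' = Ubig \<sigma> * At \<sigma> \<sigma>' * transpose_mat (Vbig \<sigma>')"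
    if "siblings L \<sigma> \<sigma>'" for \<sigma> \<sigma>'
    using that hss unfolding hss_conditions_def by blast
  show ?case
    unfolding cluster_block_split[OF assms(1,2) Suc.prems(1) \<tau>]
      off[OF siblings_children(1)[OF Suc.prems(1) \<tau>]]
      off[OF siblings_children(2)[OF Suc.prems(1) \<tau>]]
    using Suc.IH[OF nodes(1)] Suc.IH[OF nodes(2)] Suc.prems(2) by (simp add: Let_def big)
qed

lemma cluster_block_carrier:
  assumes "cluster_tree n L I" "A \<in> carrier_mat n n" "\<tau> \<in> nodes L"
  shows "cluster_block I A \<tau> \<tau> \<in> carrier_mat (length (I \<tau>)) (length (I \<tau>))"
proof -
  obtain l i where li: "\<tau> = (l, i)" by fastforce
  obtain a b where "I \<tau> = [a..<b]" "b \<le> n"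
    using cluster_tree_interval[OF assms(1), of l i] assms(3) by (auto simp: li nodes_def)
  then show ?thesis
    using assms(2) by (simp add: cluster_block_def submatrix_atLeastLessThan)
qed

theorem proposition4p2:
  fixes n L r :: nat
    and I :: "node \<Rightarrow> nat list"
    and A :: "real mat"
    and U V D :: "node \<Rightarrow> real mat"
    and At :: "node \<Rightarrow> node \<Rightarrow> real mat"
  assumes "cluster_tree n L I"
    and "hss_matrix n L I r A"
    and "data_sparse_representation L I r A U V At"
    and "\<And>\<tau>. \<tau> \<in> nodes L \<Longrightarrow> depth \<tau> = L \<Longrightarrow> D \<tau> = cluster_block I A \<tau> \<tau>"
    and "\<And>\<tau>. \<tau> \<in> nodes L \<Longrightarrow> depth \<tau> < L \<Longrightarrow>
           D \<tau> = four_block_mat (0\<^sub>m r r) (At (lchild \<tau>) (rchild \<tau>))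
                                (At (rchild \<tau>) (lchild \<tau>)) (0\<^sub>m r r)"
  shows "telescopic_decomposition L I r U V D A"
proof -
  have A: "A \<in> carrier_mat n n"
    using assms(2) by (simp add: hss_matrix_def)
  obtain Ubig Vbig where hss: "hss_conditions L I r A Ubig Vbig At U V"
    and leaf: "\<And>\<tau>. \<tau> \<in> nodes L \<Longrightarrow> 1 \<le> depth \<tau> \<Longrightarrow> depth \<tau> = L \<Longrightarrow> U \<tau> = Ubig \<tau> \<and> V \<tau> = Vbig \<tau>"
    using assms(3) by (auto simp: data_sparse_representation_def)
  have root: "I root = [0..<n]" using assms(1) by (simp add: cluster_tree_def)
  have "A = cluster_block I A root root"
    using A unfolding cluster_block_def root set_upt
    by (subst submatrix_atLeastLessThan) (auto intro!: eq_matI)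
  also have "\<dots> = assemble U V At D L root"
    by (rule cluster_block_eq_assemble[OF assms(1) A hss leaf assms(4)]) auto
  finally have assembled: "A = assemble U V At D L root" .
  have bases: "transfer_matrices L r (\<lambda>\<tau>. length (I \<tau>)) U"
      "transfer_matrices L r (\<lambda>\<tau>. length (I \<tau>)) V"
    using hss leaf unfolding transfer_matrices_def hss_conditions_def by (auto simp: nodes_def)
  have "hss_generators L r (\<lambda>\<tau>. length (I \<tau>)) U V D At"
  proof
    fix \<tau> :: node
    assume \<tau>: "\<tau> \<in> nodes L"
    show "length (I \<tau>) = length (I (lchild \<tau>)) + length (I (rchild \<tau>))" if "depth \<tau> < L"
      using assms(1) \<tau> that by (simp add: cluster_tree_def)
    show "At (lchild \<tau>) (rchild \<tau>) \<in> carrier_mat r r" "At (rchild \<tau>) (lchild \<tau>) \<in> carrier_mat r r"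
      if "depth \<tau> < L"
      using hss siblings_children[OF \<tau> that] unfolding hss_conditions_def by blast+
    show "D \<tau> \<in> carrier_mat (length (I \<tau>)) (length (I \<tau>))" if "depth \<tau> = L"
      using assms(4)[OF \<tau> that] cluster_block_carrier[OF assms(1) A \<tau>] by simp
    show "D \<tau> = four_block_mat (0\<^sub>m r r) (At (lchild \<tau>) (rchild \<tau>))
        (At (rchild \<tau>) (lchild \<tau>)) (0\<^sub>m r r)" if "depth \<tau> < L"
      by (rule assms(5)[OF \<tau> that])
  qed (use bases in auto)
  then show ?thesis
    unfolding assembled by (rule telescopic_decomposition_assemble)
qed

end
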